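(* Let $r$ and $b$ be positive integers and $\alpha = \frac{b}{r}$. If $\frac{4}{5} \le \alpha \le 1$, then \[ \mathcal{C}(r,b) \ge \frac{8}{9}(r+b-8). \]
   Context: All point sets are in general position (no three collinear). An $(r,b)$-set is a set $S=R\cup B$ of $r$ red points and $b$ blue points in general position. A subset $X\subseteq S$ can be $K_{1,3}$-covered if $X$ can be partitioned into subsets of size $4$, each consisting of one point (the center) of one color and three points of the other color, such that the straight-line segments joining each center to the three other points of its subset are pairwise non-crossing (no two intersect except at a common endpoint). $\mathcal{C}(S)$ is the maximum size of a subset of $S$ that can be $K_{1,3}$-covered, and $\mathcal{C}(r,b)$ is the minimum of $\mathcal{C}(S)$ over all $(r,b)$-sets $S$. *)

theory Defs
  imports "HOL-Analysis.Analysis" "HOL-Library.Disjoint_Sets"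
begin

type_synonym point = "real ^ 2"

definition general_position :: "point set \<Rightarrow> bool" where
  "general_position S \<longleftrightarrow> (\<forall>T\<subseteq>S. card T = 3 \<longrightarrow> \<not> collinear T)"

text \<open>A bicoloured point set \<open>S = R \<union> B\<close> is represented by the pair of its colour classes.\<close>

definition rb_set :: "nat \<Rightarrow> nat \<Rightarrow> point set \<Rightarrow> point set \<Rightarrow> bool" where
  "rb_set r b R B \<longleftrightarrow>
     finite R \<and> finite B \<and> card R = r \<and> card B = b \<and> R \<inter> B = {} \<and> general_position (R \<union> B)"

definition is_star :: "point set \<Rightarrow> point set \<Rightarrow> point \<Rightarrow> point set \<Rightarrow> bool" where
  "is_star R B c Q \<longleftrightarrow>
     card Q = 4 \<and> c \<in> Q \<and> (c \<in> R \<and> Q - {c} \<subseteq> B \<or> c \<in> B \<and> Q - {c} \<subseteq> R)"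

text \<open>The edges of the stars with vertex sets in \<open>P\<close>, as pairs (center, leaf).\<close>

definition star_edges :: "point set set \<Rightarrow> (point set \<Rightarrow> point) \<Rightarrow> (point \<times> point) set" where
  "star_edges P c = {(c Q, x) | Q x. Q \<in> P \<and> x \<in> Q - {c Q}}"

definition noncrossing :: "point \<times> point \<Rightarrow> point \<times> point \<Rightarrow> bool" where
  "noncrossing e f \<longleftrightarrow>
     closed_segment (fst e) (snd e) \<inter> closed_segment (fst f) (snd f)
       \<subseteq> {fst e, snd e} \<inter> {fst f, snd f}"

definition K13_coverable :: "point set \<Rightarrow> point set \<Rightarrow> point set \<Rightarrow> bool" where
  "K13_coverable R B X \<longleftrightarrow>
     (\<exists>P c. partition_on X P \<and> (\<forall>Q\<in>P. is_star R B (c Q) Q) \<and>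
        pairwise noncrossing (star_edges P c))"

definition C_set :: "point set \<Rightarrow> point set \<Rightarrow> nat" where
  "C_set R B = Max {card X | X. X \<subseteq> R \<union> B \<and> K13_coverable R B X}"

text \<open>The infimum of natural numbers below is a minimum, since \<open>(r,b)\<close>-sets always exist;
  see \<open>C_num_attained\<close>.\<close>

definition C_num :: "nat \<Rightarrow> nat \<Rightarrow> nat" where
  "C_num r b = Inf {C_set R B | R B. rb_set r b R B}"

lemma K13_coverable_empty: "K13_coverable R B {}"
  unfolding K13_coverable_def
  by (rule exI[of _ "{}"]) (auto simp: partition_on_def star_edges_def pairwise_def)

lemma C_set_attained:
  assumes "finite R" "finite B"
  obtains X where "X \<subseteq> R \<union> B" "K13_coverable R B X" "card X = C_set R B"
proof -
  let ?A = "{card X | X. X \<subseteq> R \<union> B \<and> K13_coverable R B X}"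
  have "?A \<subseteq> card ` Pow (R \<union> B)" by auto
  then have "finite ?A" using assms by (meson finite_Pow_iff finite_UnI finite_imageI finite_subset)
  moreover have "?A \<noteq> {}" using K13_coverable_empty by auto
  ultimately have "Max ?A \<in> ?A" by (rule Max_in)
  then show ?thesis using that unfolding C_set_def by auto
qed

lemma C_set_ge:
  assumes "finite R" "finite B" "X \<subseteq> R \<union> B" "K13_coverable R B X"
  shows "card X \<le> C_set R B"
proof -
  let ?A = "{card X | X. X \<subseteq> R \<union> B \<and> K13_coverable R B X}"
  have "?A \<subseteq> card ` Pow (R \<union> B)" by auto
  then have "finite ?A" using assms by (meson finite_Pow_iff finite_UnI finite_imageI finite_subset)
  then show ?thesis unfolding C_set_def using assms by (intro Max_ge) auto
qed

definition parabola_point :: "nat \<Rightarrow> point" where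
  "parabola_point n = vector [real n, (real n)\<^sup>2]"

lemma inj_parabola_point: "inj parabola_point"
  by (rule injI) (metis parabola_point_def of_nat_eq_iff vector_2(1))

lemma general_position_parabola: "general_position (parabola_point ` N)"
  unfolding general_position_def
proof (intro allI impI notI)
  fix T assume T: "T \<subseteq> parabola_point ` N" "card T = 3" "collinear T"
  from T(2) obtain x y z where xyz: "T = {x, y, z}" "x \<noteq> y" "x \<noteq> z" "y \<noteq> z"
    by (auto simp: card_3_iff)
  obtain i j k where ijk: "x = parabola_point i" "y = parabola_point j" "z = parabola_point k"
    using T(1) unfolding xyz(1) by auto
  from T(3) obtain u where u: "\<forall>p\<in>T. \<forall>q\<in>T. \<exists>a. p - q = a *\<^sub>R u"
    unfolding collinear_def by blast
  have "\<exists>s. y - x = s *\<^sub>R u" "\<exists>t. z - x = t *\<^sub>R u" using u unfolding xyz(1) by simp_all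
  then obtain s t where s: "y - x = s *\<^sub>R u" and t: "z - x = t *\<^sub>R u" by blast
  have "(y - x) $ 1 * (z - x) $ 2 - (y - x) $ 2 * (z - x) $ 1 = 0"
    unfolding s t by simp
  then have "(real j - real i) * ((real k)\<^sup>2 - (real i)\<^sup>2) - ((real j)\<^sup>2 - (real i)\<^sup>2) * (real k - real i) = 0"
    unfolding ijk parabola_point_def by simp
  then have "(real j - real i) * (real k - real i) * (real k - real j) = 0"
    by algebra
  then have "i = j \<or> i = k \<or> j = k" by auto
  then show False using xyz(2-4) unfolding ijk by blast
qed

lemma rb_set_exists: "\<exists>R B. rb_set r b R B"
proof (intro exI)
  have "parabola_point ` {..<r} \<inter> parabola_point ` {r..<r + b} = {}"
    by (auto simp: inj_eq[OF inj_parabola_point])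
  then show "rb_set r b (parabola_point ` {..<r}) (parabola_point ` {r..<r + b})"
    unfolding rb_set_def image_Un[symmetric]
    using general_position_parabola
    by (simp add: card_image inj_on_subset[OF inj_parabola_point])
qed

lemma C_num_attained: obtains R B where "rb_set r b R B" "C_num r b = C_set R B"
proof -
  have "{C_set R B | R B. rb_set r b R B} \<noteq> {}" using rb_set_exists by auto
  from Inf_nat_def1[OF this] show ?thesis using that unfolding C_num_def by auto
qed

lemma C_num_le: "rb_set r b R B \<Longrightarrow> C_num r b \<le> C_set R B"
  unfolding C_num_def by (rule cInf_lower) auto

end

theory Submission
  imports Defs
begin

text \<open>
  A set of \<open>9g\<close> points with between \<open>2g\<close> and \<open>7g\<close> red ones contains \<open>2g\<close> disjoint non-crossing
  stars. When all centers may have the same colour (at most \<open>3g\<close> or at least \<open>6g\<close> red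
  points), an assignment of leaves to centers of minimal total length is non-crossing. Otherwise
  a line splits the set into two smaller sets of the same kind: rotating a line that cuts off a
  fixed number of points changes the number of red points cut off by at most one at a time, so all
  intermediate values occur. For \<open>g\<close> even the line halves both colours. For \<open>g = 2k + 1 \<ge> 5\<close>, some
  line that cuts off \<open>9k\<close> points is close enough to halving the red points. The remaining cases
  \<open>g = 1\<close> and \<open>g = 3\<close> are settled by rotating lines that cut off four, five or nine points. In the theorem the at most eight points left over modulo 9 are discarded.
\<close>

section \<open>Cutting a point set by lines\<close>

text \<open>For finite \<open>S\<close> the pairwise strict inequalities leave room for a threshold,
  so a line with normal \<open>u\<close> separates \<open>C\<close> from the rest, and no threshold
  has to be carried along.\<close>

definition cut :: "point set \<Rightarrow> point set \<Rightarrow> bool" where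
  "cut S C \<longleftrightarrow> C \<subseteq> S \<and> (\<exists>u. \<forall>x\<in>C. \<forall>y\<in>S - C. u \<bullet> x < u \<bullet> y)"

lemma cut_subset: "cut S C \<Longrightarrow> C \<subseteq> S"
  unfolding cut_def by blast

lemma cut_Diff: "cut S C \<Longrightarrow> cut S (S - C)"
proof -
  assume "cut S C"
  then obtain u where "C \<subseteq> S" "\<forall>x\<in>C. \<forall>y\<in>S - C. u \<bullet> x < u \<bullet> y"
    unfolding cut_def by blast
  then have "\<forall>x\<in>S - C. \<forall>y\<in>S - (S - C). (- u) \<bullet> x < (- u) \<bullet> y" by auto
  then show ?thesis unfolding cut_def by blast
qed

lemma general_position_subset: "general_position S \<Longrightarrow> T \<subseteq> S \<Longrightarrow> general_position T"
  unfolding general_position_def by blast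

lemma general_position_not_collinear:
  assumes "general_position S" "x \<in> S" "y \<in> S" "z \<in> S" "x \<noteq> y" "x \<noteq> z" "y \<noteq> z"
  shows "\<not> collinear {x, y, z}"
proof -
  have "card {x, y, z} = 3" "{x, y, z} \<subseteq> S" using assms by auto
  then show ?thesis using assms(1) unfolding general_position_def by blast
qed

section \<open>Level lines of linear functionals and small perturbations\<close>

lemma inner_point: "(x::point) \<bullet> y = x $ 1 * y $ 1 + x $ 2 * y $ 2"
  by (simp add: inner_vec_def sum_2)

lemma orthogonal_points_parallel:
  fixes w z :: point
  assumes "w \<noteq> 0" "w \<bullet> z = 0"
  shows "\<exists>a. z = a *\<^sub>R vector [- (w $ 2), w $ 1]"
proof
  have pos: "(w $ 1)\<^sup>2 + (w $ 2)\<^sup>2 \<noteq> 0"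
    using assms(1) by (simp add: vec_eq_iff forall_2 sum_power2_eq_zero_iff)
  have ort: "w $ 1 * z $ 1 + w $ 2 * z $ 2 = 0" using assms(2) by (simp add: inner_point)
  \<comment> \<open>The coefficient of \<open>z\<close> along \<open>w\<close> turned by a right
    angle: inner product over squared norm.\<close>
  let ?a = "(z $ 2 * w $ 1 - z $ 1 * w $ 2) / ((w $ 1)\<^sup>2 + (w $ 2)\<^sup>2)"
  have "z $ 1 * ((w $ 1)\<^sup>2 + (w $ 2)\<^sup>2) = (z $ 2 * w $ 1 - z $ 1 * w $ 2) * (- (w $ 2))"
    "z $ 2 * ((w $ 1)\<^sup>2 + (w $ 2)\<^sup>2) = (z $ 2 * w $ 1 - z $ 1 * w $ 2) * w $ 1"
    using ort by algebra+
  then show "z = ?a *\<^sub>R vector [- (w $ 2), w $ 1]"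
    using pos by (simp add: vec_eq_iff forall_2 field_simps)
qed

lemma collinear_level_line:
  fixes w :: point
  assumes "w \<noteq> 0" "\<And>x. x \<in> T \<Longrightarrow> w \<bullet> x = c"
  shows "collinear T"
  unfolding collinear_def
proof (rule exI[of _ "vector [- (w $ 2), w $ 1]"], intro ballI)
  fix x y assume "x \<in> T" "y \<in> T"
  then have "w \<bullet> (x - y) = 0" using assms(2) by (simp add: inner_diff_right)
  then show "\<exists>a. x - y = a *\<^sub>R vector [- (w $ 2), w $ 1]"
    using orthogonal_points_parallel assms(1) by blast
qed

text \<open>Each of the finitely many inequalities survives for all small \<open>e > 0\<close> by
  continuity at 0.\<close>

lemma small_perturbation_pos:
  fixes f g :: "'a \<Rightarrow> real"
  assumes "finite K" "\<And>k. k \<in> K \<Longrightarrow> f k > 0"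
  shows "\<exists>e>0. \<forall>k\<in>K. f k + e * g k > 0"
proof -
  have "\<forall>\<^sub>F e in at_right 0. f k + e * g k > 0" if "k \<in> K" for k
  proof -
    have "((\<lambda>e. f k + e * g k) \<longlongrightarrow> f k + 0 * g k) (at_right 0)"
      by (intro tendsto_intros)
    then show ?thesis using assms(2)[OF that] by (intro order_tendstoD(1)) auto
  qed
  then have "\<forall>\<^sub>F e in at_right 0. \<forall>k\<in>K. f k + e * g k > 0"
    using assms(1) by (simp add: eventually_ball_finite)
  then have "\<forall>\<^sub>F e::real in at_right 0. e > 0 \<and> (\<forall>k\<in>K. f k + e * g k > 0)"
    using eventually_at_right_less eventually_conj by blast
  then show ?thesis using eventually_happens'[OF trivial_limit_at_right_real] by blast
qed

lemma finite_obtains_minimizer: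
  fixes f :: "'a \<Rightarrow> real"
  assumes "finite H" "H \<noteq> {}"
  obtains h where "h \<in> H" "\<And>h'. h' \<in> H \<Longrightarrow> f h \<le> f h'"
  using that[of "arg_min_on f H"] arg_min_if_finite(1)[OF assms] arg_min_least[OF assms] by blast

text \<open>Induction on the number of pairs that \<open>u\<close> and \<open>v\<close> order
  oppositely. Move \<open>u\<close> towards \<open>v\<close> until a point of \<open>C\<close> first
  ties with a point outside, exchange the two and go slightly further. The last hypothesis keeps the
  functional nonzero on the way, so that its level sets are lines.\<close>

lemma rotate_cut_between:
  fixes u v :: point
  assumes S: "finite S" "general_position S"
    and "C \<subseteq> S" "\<forall>x\<in>C. \<forall>y\<in>S - C. u \<bullet> x < u \<bullet> y"
    and "D \<subseteq> S" "\<forall>x\<in>D. \<forall>y\<in>S - D. v \<bullet> x < v \<bullet> y"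
    and "card C = card D" "Q C" "\<not> Q D"
    and "\<forall>a b. a \<ge> 0 \<longrightarrow> b \<ge> 0 \<longrightarrow> a + b > 0 \<longrightarrow> a *\<^sub>R u + b *\<^sub>R v \<noteq> 0"
  shows "\<exists>A x y. x \<notin> A \<and> y \<notin> A \<and> x \<noteq> y \<and> cut S (insert x A) \<and> cut S (insert y A) \<and>
    cut S (insert x (insert y A)) \<and> Suc (card A) = card D \<and> Q (insert x A) \<and> \<not> Q (insert y A)"
  using assms(3-4) assms(7,8,10)
proof (induction "card {(p, q). p \<in> S \<and> q \<in> S \<and> u \<bullet> p < u \<bullet> q \<and> v \<bullet> q < v \<bullet> p}"
    arbitrary: u C rule: less_induct)
  case less
  note C = less.prems(1,2) and cC = less.prems(3) and QC = less.prems(4) and cone = less.prems(5)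
  note D = assms(5,6)
  let ?I = "{(x, y). x \<in> C \<and> y \<in> S - C \<and> v \<bullet> y < v \<bullet> x}"
  \<comment> \<open>The parameter \<open>t\<close> at which
    \<open>(1 - t) *\<^sub>R u + t *\<^sub>R v\<close> takes equal values at \<open>x\<close> and
    \<open>y\<close>.\<close>
  let ?t = "\<lambda>(x, y). u \<bullet> (y - x) / (u \<bullet> (y - x) + v \<bullet> (x - y))"
  have fin: "finite C" "finite D" using C D S by (auto intro: finite_subset)
  \<comment> \<open>Distinct sets of equal size each have a point outside the other; such a pair
    shows that \<open>?I\<close> is nonempty.\<close>
  have "C \<noteq> D" using QC assms(9) by blast
  then have "\<not> C \<subseteq> D" "\<not> D \<subseteq> C" using cC fin by (metis card_subset_eq)+
  then obtain x1 y1 where "x1 \<in> C" "x1 \<notin> D" "y1 \<in> D" "y1 \<notin> C" by blast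
  then have "(x1, y1) \<in> ?I" using C D by auto
  moreover have "finite ?I"
    by (rule finite_subset[of _ "S \<times> S"]) (use C S in auto)
  ultimately obtain z where z: "z \<in> ?I" "\<And>p. p \<in> ?I \<Longrightarrow> ?t z \<le> ?t p"
    using finite_obtains_minimizer[of ?I ?t] by (metis (no_types, lifting) empty_iff)
  obtain x0 y0 where z_eq: "z = (x0, y0)" by (cases z)
  have x0: "x0 \<in> C" and y0: "y0 \<in> S" "y0 \<notin> C" and v0: "v \<bullet> y0 < v \<bullet> x0"
    using z(1) z_eq by auto
  have u0: "u \<bullet> x0 < u \<bullet> y0" using C x0 y0 by auto
  define t where "t = u \<bullet> (y0 - x0) / (u \<bullet> (y0 - x0) + v \<bullet> (x0 - y0))"
  have den: "u \<bullet> (y0 - x0) > 0" "v \<bullet> (x0 - y0) > 0" using u0 v0 by (auto simp: inner_diff_right)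
  then have t: "0 < t" "t < 1" unfolding t_def by (auto simp: field_simps)
  define w where "w = (1 - t) *\<^sub>R u + t *\<^sub>R v"
  have w_eq: "w \<bullet> p = (1 - t) * (u \<bullet> p) + t * (v \<bullet> p)" for p
    unfolding w_def by (simp add: inner_add_left)
  have "w \<noteq> 0" unfolding w_def using cone t by auto
  have tie: "w \<bullet> x0 = w \<bullet> y0"
  proof -
    have "t * (u \<bullet> (y0 - x0) + v \<bullet> (x0 - y0)) = u \<bullet> (y0 - x0)"
      unfolding t_def using den by simp
    then show ?thesis unfolding w_eq by (simp add: inner_diff_right algebra_simps)
  qed
  \<comment> \<open>Since \<open>t\<close> is the least tie parameter, at \<open>w\<close> no point
    of \<open>C\<close> has yet passed a point outside \<open>C\<close>.\<close>
  have weak: "w \<bullet> x \<le> w \<bullet> y" if "x \<in> C" "y \<in> S - C" for x y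
  proof -
    have ux: "u \<bullet> x < u \<bullet> y" using C that by auto
    show ?thesis
    proof (cases "v \<bullet> y < v \<bullet> x")
      case False
      then show ?thesis unfolding w_eq using ux t
        by (intro add_mono mult_left_mono) auto
    next
      case True
      then have "(x, y) \<in> ?I" using that by auto
      from z(2)[OF this] have le: "t \<le> u \<bullet> (y - x) / (u \<bullet> (y - x) + v \<bullet> (x - y))"
        unfolding z_eq t_def by simp
      have "u \<bullet> (y - x) + v \<bullet> (x - y) > 0" using ux True by (simp add: inner_diff_right)
      then have "t * (u \<bullet> (y - x) + v \<bullet> (x - y)) \<le> u \<bullet> (y - x)"
        using le by (simp add: field_simps)
      then show ?thesis unfolding w_eq by (simp add: inner_diff_right algebra_simps)
    qed
  qed
  \<comment> \<open>General position: the level line of \<open>w\<close> through \<open>x0\<close>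
    and \<open>y0\<close> has no third point of \<open>S\<close>. Ties at other levels do no
    harm.\<close>
  have only: "w \<bullet> p \<noteq> w \<bullet> x0" if "p \<in> S" "p \<noteq> x0" "p \<noteq> y0" for p
  proof
    assume "w \<bullet> p = w \<bullet> x0"
    then have "collinear {p, x0, y0}"
      using tie by (intro collinear_level_line[OF \<open>w \<noteq> 0\<close>, of _ "w \<bullet> x0"]) auto
    moreover have "x0 \<in> S" "x0 \<noteq> y0" using x0 y0 C by auto
    ultimately show False using general_position_not_collinear[OF S(2)] that y0 by blast
  qed
  define A where "A = C - {x0}"
  have C_eq: "C = insert x0 A" "x0 \<notin> A" "y0 \<notin> A" "x0 \<noteq> y0" using x0 y0 unfolding A_def by auto
  have low: "w \<bullet> x < w \<bullet> x0" if "x \<in> A" for x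
    using weak[of x y0] only[of x] tie that y0 C unfolding A_def by force
  have high: "w \<bullet> x0 < w \<bullet> y" if "y \<in> S" "y \<notin> C" "y \<noteq> y0" for y
    using weak[OF x0, of y] only[of y] that x0 by force
  have cut2: "cut S (insert x0 (insert y0 A))"
    unfolding cut_def
  proof (intro conjI exI ballI)
    show "insert x0 (insert y0 A) \<subseteq> S" using C y0 C_eq by auto
    fix x y assume "x \<in> insert x0 (insert y0 A)" "y \<in> S - insert x0 (insert y0 A)"
    then show "w \<bullet> x < w \<bullet> y" using low[of x] high[of y] tie C_eq by auto
  qed
  let ?C = "insert y0 A"
  let ?K = "{(x, y). x \<in> S \<and> y \<in> S \<and> w \<bullet> x < w \<bullet> y}"
  have "finite ?K" by (rule finite_subset[of _ "S \<times> S"]) (use S in auto)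
  \<comment> \<open>So small that all strict inequalities under \<open>w\<close> persist; the tie is
    then broken by \<open>v\<close>, which puts \<open>y0\<close> first.\<close>
  then obtain e where e: "e > 0"
    "\<forall>k\<in>?K. (\<lambda>(x, y). w \<bullet> (y - x)) k + e * (\<lambda>(x, y). v \<bullet> (y - x)) k > 0"
    using small_perturbation_pos[of ?K "\<lambda>(x, y). w \<bullet> (y - x)" "\<lambda>(x, y). v \<bullet> (y - x)"]
    by (auto simp: inner_diff_right)
  define u' where "u' = w + e *\<^sub>R v"
  have u'_eq: "u' \<bullet> p = w \<bullet> p + e * (v \<bullet> p)" for p
    unfolding u'_def by (simp add: inner_add_left)
  have keep: "u' \<bullet> x < u' \<bullet> y" if "x \<in> S" "y \<in> S" "w \<bullet> x < w \<bullet> y" for x y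
    using e(2) that unfolding u'_eq by (force simp: inner_diff_right algebra_simps)
  have swap: "u' \<bullet> y0 < u' \<bullet> x0" unfolding u'_eq using tie v0 e(1) by simp
  have sub': "?C \<subseteq> S" using C y0 C_eq by auto
  have sep': "\<forall>x\<in>?C. \<forall>y\<in>S - ?C. u' \<bullet> x < u' \<bullet> y"
  proof (intro ballI)
    fix x y assume xy: "x \<in> ?C" "y \<in> S - ?C"
    show "u' \<bullet> x < u' \<bullet> y"
    proof (cases "x = y0 \<and> y = x0")
      case True
      then show ?thesis using swap by simp
    next
      case False
      then have "w \<bullet> x < w \<bullet> y" using xy low[of x] high[of y] tie C_eq
        by (cases "y = x0") auto
      then show ?thesis using keep xy sub' by blast
    qed
  qed
  have cut': "cut S ?C" unfolding cut_def using sub' sep' by blast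
  have cutC: "cut S (insert x0 A)" unfolding cut_def using C C_eq by blast
  have cards: "Suc (card A) = card D" "card ?C = card D"
    using cC fin C_eq by auto
  show ?case
  proof (cases "Q ?C")
    case False
    then show ?thesis using C_eq cutC cut' cut2 cards QC by blast
  next
    case True
    let ?J = "\<lambda>u. {(p, q). p \<in> S \<and> q \<in> S \<and> u \<bullet> p < u \<bullet> q \<and> v \<bullet> q < v \<bullet> p}"
    \<comment> \<open>A positive multiple of \<open>u\<close> is \<open>u'\<close> minus a positive
      multiple of \<open>v\<close>, so a pair on which \<open>u'\<close> and \<open>v\<close>
      disagree is one on which \<open>u\<close> and \<open>v\<close> disagree. The pair
      \<open>(x0, y0)\<close> is settled for good.\<close>
    have "?J u' \<subset> ?J u"
    proof
      show "?J u' \<subseteq> ?J u"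
      proof clarify
        fix p q assume pq: "u' \<bullet> p < u' \<bullet> q" "v \<bullet> q < v \<bullet> p"
        have "(t + e) * (v \<bullet> q) < (t + e) * (v \<bullet> p)" using pq(2) t e(1) by simp
        then have "(1 - t) * (u \<bullet> p) < (1 - t) * (u \<bullet> q)"
          using pq(1) unfolding u'_eq w_eq by (simp add: algebra_simps)
        then show "u \<bullet> p < u \<bullet> q" using t by simp
      qed
      have "(x0, y0) \<in> ?J u" "(x0, y0) \<notin> ?J u'" using x0 y0 C u0 v0 swap by auto
      then show "?J u' \<noteq> ?J u" by blast
    qed
    moreover have "finite (?J u)" by (rule finite_subset[of _ "S \<times> S"]) (use S in auto)
    ultimately have less_card: "card (?J u') < card (?J u)" by (rule psubset_card_mono[rotated])
    have "a *\<^sub>R u' + b *\<^sub>R v \<noteq> 0" if "a \<ge> 0" "b \<ge> 0" "a + b > 0" for a b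
    proof -
      have "a *\<^sub>R u' + b *\<^sub>R v = (a * (1 - t)) *\<^sub>R u + (a * (t + e) + b) *\<^sub>R v"
        unfolding u'_def w_def by (simp add: algebra_simps)
      moreover have "a * (1 - t) + (a * (t + e) + b) = a + b + a * e" by (simp add: algebra_simps)
      then have "a * (1 - t) + (a * (t + e) + b) > 0"
        using that e(1) mult_nonneg_nonneg[of a e] by linarith
      moreover have "a * (1 - t) \<ge> 0" "a * (t + e) + b \<ge> 0" using that t e by auto
      ultimately show ?thesis
        using cone[rule_format, of "a * (1 - t)" "a * (t + e) + b"] by metis
    qed
    then have "\<forall>a b. a \<ge> 0 \<longrightarrow> b \<ge> 0 \<longrightarrow> a + b > 0 \<longrightarrow> a *\<^sub>R u' + b *\<^sub>R v \<noteq> 0"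
      by (intro allI impI)
    then show ?thesis by (rule less.hyps[OF less_card sub' sep' cards(2) True])
  qed
qed

text \<open>Rotating a line from one cut to another of the same size exchanges one point at a time: at
  the moment of the exchange the line passes through exactly the two points that trade places.\<close>

lemma rotate_cut:
  assumes S: "finite S" "general_position S"
    and "cut S C" "cut S D" "card C = card D" "Q C" "\<not> Q D"
  obtains A x y where "x \<notin> A" "y \<notin> A" "x \<noteq> y" "cut S (insert x A)" "cut S (insert y A)"
    "cut S (insert x (insert y A))" "Suc (card A) = card D" "Q (insert x A)" "\<not> Q (insert y A)"
proof -
  obtain u where C: "C \<subseteq> S" "\<forall>x\<in>C. \<forall>y\<in>S - C. u \<bullet> x < u \<bullet> y"
    using assms(3) unfolding cut_def by blast
  obtain v where D: "D \<subseteq> S" "\<forall>x\<in>D. \<forall>y\<in>S - D. v \<bullet> x < v \<bullet> y"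
    using assms(4) unfolding cut_def by blast
  have fin: "finite C" "finite D" using C D S by (auto intro: finite_subset)
  have "C \<noteq> D" using assms by blast
  then have "\<not> C \<subseteq> D" "\<not> D \<subseteq> C" using assms(5) fin by (metis card_subset_eq)+
  then obtain x1 y1 where "x1 \<in> C" "x1 \<notin> D" "y1 \<in> D" "y1 \<notin> C" by blast
  then have "u \<bullet> x1 < u \<bullet> y1" using C D by auto
  then have "u \<noteq> 0" by auto
  \<comment> \<open>If \<open>v\<close> points opposite to \<open>u\<close>, the segment between
    them passes through 0. A small tilt of \<open>v\<close> along \<open>w\<close>, orthogonal to
    \<open>u\<close>, preserves the cut \<open>D\<close> and makes the product with \<open>w\<close>
    positive, which excludes this.\<close>
  define w0 :: point where "w0 = vector [- (u $ 2), u $ 1]"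
  define w where "w = (if v \<bullet> w0 \<ge> 0 then w0 else - w0)"
  have w: "u \<bullet> w = 0" "w \<noteq> 0" "v \<bullet> w \<ge> 0"
    using \<open>u \<noteq> 0\<close> unfolding w_def w0_def by (auto simp: inner_point vec_eq_iff forall_2)
  let ?K = "D \<times> (S - D)"
  have "\<exists>e>0. \<forall>k\<in>?K. (\<lambda>(x, y). v \<bullet> (y - x)) k + e * (\<lambda>(x, y). w \<bullet> (y - x)) k > 0"
    by (rule small_perturbation_pos) (use S fin D in \<open>auto simp: inner_diff_right\<close>)
  then obtain e where e: "e > 0" "\<forall>x\<in>D. \<forall>y\<in>S - D. v \<bullet> (y - x) + e * (w \<bullet> (y - x)) > 0"
    by auto
  define v' where "v' = v + e *\<^sub>R w"
  have D': "\<forall>x\<in>D. \<forall>y\<in>S - D. v' \<bullet> x < v' \<bullet> y"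
    using e(2) unfolding v'_def by (auto simp: inner_diff_right inner_add_left algebra_simps)
  have "a *\<^sub>R u + b *\<^sub>R v' \<noteq> 0" if "a \<ge> 0" "b \<ge> 0" "a + b > 0" for a b
  proof
    assume zero: "a *\<^sub>R u + b *\<^sub>R v' = 0"
    then have "(a *\<^sub>R u + b *\<^sub>R v') \<bullet> w = 0" by simp
    then have "b * (v \<bullet> w + e * (w \<bullet> w)) = 0"
      using w unfolding v'_def by (simp add: inner_add_left)
    moreover have "v \<bullet> w + e * (w \<bullet> w) > 0" using w e(1) by (simp add: add_nonneg_pos)
    ultimately have "b = 0" by simp
    then show False using zero that \<open>u \<noteq> 0\<close> by auto
  qed
  then have "\<forall>a b. a \<ge> 0 \<longrightarrow> b \<ge> 0 \<longrightarrow> a + b > 0 \<longrightarrow> a *\<^sub>R u + b *\<^sub>R v' \<noteq> 0"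
    by (intro allI impI)
  from rotate_cut_between[OF S C D(1) D' assms(5-7) this] that show ?thesis by metis
qed

section \<open>Intermediate values of colour counts\<close>

lemma card_insert_Int:
  assumes "finite A" "x \<notin> A"
  shows "card (insert x A \<inter> R) = card (A \<inter> R) + (if x \<in> R then 1 else 0)"
  using assms by (auto simp: Int_insert_left)

text \<open>At the exchange where the red count first exceeds \<open>v\<close> it changes by at most
  one, so just before it equals \<open>v\<close>.\<close>

lemma cut_intermediate_value:
  assumes S: "finite S" "general_position S"
    and "cut S C" "cut S D" "card C = m" "card D = m"
    and "card (C \<inter> R) \<le> v" "v \<le> card (D \<inter> R)"
  obtains E where "cut S E" "card E = m" "card (E \<inter> R) = v"
proof (cases "card (D \<inter> R) = v")
  case True
  then show ?thesis using that assms by blast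
next
  case False
  have cCD: "card C = card D" using assms by simp
  have "\<not> card (D \<inter> R) \<le> v" using False assms by simp
  from rotate_cut[where Q = "\<lambda>E. card (E \<inter> R) \<le> v", OF S assms(3,4) cCD assms(7) this]
  obtain A x y where A: "x \<notin> A" "y \<notin> A" "cut S (insert x A)" "Suc (card A) = card D"
    "card (insert x A \<inter> R) \<le> v" "\<not> card (insert y A \<inter> R) \<le> v" by metis
  have "finite A" using cut_subset[OF A(3)] S(1) finite_subset by auto
  then have "card (insert x A \<inter> R) = v" "card (insert x A) = m"
    using A assms(6) by (auto simp: card_insert_Int split: if_splits)
  then show ?thesis using that A(3) by blast
qed

lemma cut_intermediate_range:
  assumes S: "finite S" "general_position S"
    and "cut S C" "cut S D" "card C = m" "card D = m"
    and "card (C \<inter> R) \<le> b" "a \<le> card (D \<inter> R)" "a \<le> b"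
  obtains E where "cut S E" "card E = m" "a \<le> card (E \<inter> R)" "card (E \<inter> R) \<le> b"
proof (cases "a \<le> card (C \<inter> R)")
  case True
  then show ?thesis using that assms by blast
next
  case False
  then have "card (C \<inter> R) \<le> a" by simp
  from cut_intermediate_value[OF S assms(3-6) this assms(8)] that assms(9) show ?thesis by auto
qed

text \<open>The points in the order in which a line of fixed direction passes them. In list form
  every split into prefix and suffix is a cut, so parallel cuts are described by appending
  blocks.\<close>

definition sweep :: "point list \<Rightarrow> bool" where
  "sweep xs \<longleftrightarrow> (\<exists>u. sorted_wrt (\<lambda>x y. u \<bullet> x < u \<bullet> y) xs)"

lemma sweep_distinct: "sweep xs \<Longrightarrow> distinct xs"
  unfolding sweep_def
  by (auto simp: distinct_conv_nth sorted_wrt_iff_nth_less)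
    (metis linorder_neqE_nat order_less_irrefl)

lemma sweep_append: "sweep (xs @ ys) \<Longrightarrow> sweep xs" "sweep (xs @ ys) \<Longrightarrow> sweep ys"
  unfolding sweep_def by (auto simp: sorted_wrt_append)

lemma sweep_rev: "sweep xs \<Longrightarrow> sweep (rev xs)"
proof -
  assume "sweep xs"
  then obtain u where "sorted_wrt (\<lambda>x y. u \<bullet> x < u \<bullet> y) xs" unfolding sweep_def by blast
  then have "sorted_wrt (\<lambda>x y. (- u) \<bullet> x < (- u) \<bullet> y) (rev xs)"
    by (simp add: sorted_wrt_rev)
  then show ?thesis unfolding sweep_def by blast
qed

lemma sweep_cut:
  assumes "sweep (xs @ ys)"
  shows "cut (set (xs @ ys)) (set xs)" "cut (set (xs @ ys)) (set ys)"
proof -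
  show *: "cut (set (xs @ ys)) (set xs)"
    using assms unfolding sweep_def cut_def by (auto simp: sorted_wrt_append)
  have "set (xs @ ys) - set xs = set ys" using sweep_distinct[OF assms] by auto
  then show "cut (set (xs @ ys)) (set ys)" using cut_Diff[OF *] by simp
qed

lemma exists_injective_functional:
  assumes "finite (S :: point set)"
  obtains u :: point where "inj_on (\<lambda>x. u \<bullet> x) S"
proof -
  \<comment> \<open>The values of \<open>t\<close> for which \<open>vector [1, t]\<close> can tie
    points with different second coordinates. Pairs with equal second coordinate contribute only 0,
    by division by zero, and are tied only if equal.\<close>
  let ?F = "(\<lambda>(x, y). - (x $ 1 - y $ 1) / (x $ 2 - y $ 2)) ` (S \<times> S)"
  have "finite ?F" using assms by simp
  then obtain t :: real where t: "t \<notin> ?F" using ex_new_if_finite infinite_UNIV_char_0 by blast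
  have "inj_on (\<lambda>x. (vector [1, t] :: point) \<bullet> x) S"
  proof (rule inj_onI, rule ccontr)
    fix x y assume xy: "x \<in> S" "y \<in> S" "(vector [1, t] :: point) \<bullet> x = vector [1, t] \<bullet> y" "x \<noteq> y"
    then have eq: "x $ 1 + t * x $ 2 = y $ 1 + t * y $ 2" by (simp add: inner_point)
    then have "x $ 2 \<noteq> y $ 2" using xy(4) by (auto simp: vec_eq_iff forall_2)
    then have "t = - (x $ 1 - y $ 1) / (x $ 2 - y $ 2)" using eq by (simp add: field_simps)
    then show False using t xy by force
  qed
  then show ?thesis using that by blast
qed

lemma exists_sweep:
  assumes "finite S"
  obtains xs where "sweep xs" "set xs = S"
proof -
  obtain u where u: "inj_on (\<lambda>x. u \<bullet> x) S" using exists_injective_functional[OF assms] .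
  obtain ys where ys: "set ys = S" "distinct ys" using finite_distinct_list[OF assms] by blast
  let ?xs = "sort_key (\<lambda>x. u \<bullet> x) ys"
  have "sorted (map (\<lambda>x. u \<bullet> x) ?xs)" "distinct (map (\<lambda>x. u \<bullet> x) ?xs)"
    using u ys by (auto simp: distinct_map)
  then have "sorted_wrt (<) (map (\<lambda>x. u \<bullet> x) ?xs)" by (simp add: strict_sorted_iff)
  then have "sweep ?xs" unfolding sweep_def sorted_wrt_map by blast
  then show ?thesis using that ys by simp
qed

section \<open>Packings of stars\<close>

text \<open>Points of \<open>S\<close> may stay uncovered and only the number of stars is recorded,
  so packings pass to supersets and add up across a cut.\<close>

definition star_packing :: "point set \<Rightarrow> point set \<Rightarrow> point set \<Rightarrow> nat \<Rightarrow> bool" where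
  "star_packing R B S k \<longleftrightarrow> (\<exists>P c. finite P \<and> card P = k \<and> \<Union>P \<subseteq> S \<and> disjoint P \<and>
     (\<forall>Q\<in>P. is_star R B (c Q) Q) \<and> pairwise noncrossing (star_edges P c))"

lemma star_packing_swap: "star_packing R B S k \<Longrightarrow> star_packing B R S k"
proof -
  have "is_star R B c Q \<longleftrightarrow> is_star B R c Q" for c Q unfolding is_star_def by auto
  then show "star_packing R B S k \<Longrightarrow> star_packing B R S k" unfolding star_packing_def by simp
qed

lemma star_packing_mono: "star_packing R B S k \<Longrightarrow> S \<subseteq> T \<Longrightarrow> star_packing R B T k"
  unfolding star_packing_def by blast

lemma is_star_center: "is_star R B c Q \<Longrightarrow> c \<in> Q"
  unfolding is_star_def by blast

lemma star_edges_UN: "star_edges P c = (\<Union>Q\<in>P. {c Q} \<times> (Q - {c Q}))"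
  unfolding star_edges_def by auto

lemma star_edges_subset:
  assumes "\<forall>Q\<in>P. is_star R B (c Q) Q"
  shows "star_edges P c \<subseteq> \<Union>P \<times> \<Union>P"
  using assms is_star_center unfolding star_edges_def by fast

section \<open>Joining packings on the two sides of a line\<close>

lemma inner_closed_segment_le:
  assumes "z \<in> closed_segment a b" "u \<bullet> a \<le> d" "u \<bullet> b \<le> d"
  shows "u \<bullet> z \<le> d"
proof -
  have "convex {x. u \<bullet> x \<le> d}" by (rule convex_halfspace_le)
  then have "closed_segment a b \<subseteq> {x. u \<bullet> x \<le> d}" using assms by (intro closed_segment_subset) auto
  then show ?thesis using assms(1) by blast
qed

lemma separated_segments_disjoint:
  assumes "\<forall>x\<in>C. \<forall>y\<in>D. u \<bullet> x < u \<bullet> y" "a \<in> C" "b \<in> C" "a' \<in> D" "b' \<in> D"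
  shows "closed_segment a b \<inter> closed_segment a' b' = {}"
proof (rule ccontr)
  assume "\<not> ?thesis"
  then obtain z where z: "z \<in> closed_segment a b" "z \<in> closed_segment a' b'" by blast
  have "u \<bullet> z \<le> max (u \<bullet> a) (u \<bullet> b)" using inner_closed_segment_le[OF z(1)] by simp
  moreover have "(- u) \<bullet> z \<le> max ((- u) \<bullet> a') ((- u) \<bullet> b')"
    using inner_closed_segment_le[OF z(2)] by (metis max.cobounded1 max.cobounded2)
  then have "min (u \<bullet> a') (u \<bullet> b') \<le> u \<bullet> z" by (auto simp: max_def min_def split: if_splits)
  moreover have "max (u \<bullet> a) (u \<bullet> b) < min (u \<bullet> a') (u \<bullet> b')" using assms by simp
  ultimately show False by linarith
qed

lemma star_packing_cut:
  assumes "cut S C" "star_packing R B C k" "star_packing R B (S - C) l"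
  shows "star_packing R B S (k + l)"
proof -
  obtain u where C: "C \<subseteq> S" "\<forall>x\<in>C. \<forall>y\<in>S - C. u \<bullet> x < u \<bullet> y"
    using assms(1) unfolding cut_def by blast
  obtain P c where P: "finite P" "card P = k" "\<Union>P \<subseteq> C" "disjoint P"
    "\<forall>Q\<in>P. is_star R B (c Q) Q" "pairwise noncrossing (star_edges P c)"
    using assms(2) unfolding star_packing_def by blast
  obtain P' c' where P': "finite P'" "card P' = l" "\<Union>P' \<subseteq> S - C" "disjoint P'"
    "\<forall>Q\<in>P'. is_star R B (c' Q) Q" "pairwise noncrossing (star_edges P' c')"
    using assms(3) unfolding star_packing_def by blast
  have "Q \<noteq> {}" if "Q \<in> P" for Q using P(5) that is_star_center by blast
  then have disj: "P \<inter> P' = {}" using P(3) P'(3) by blast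
  \<comment> \<open>One center function for both families; stars are nonempty, so no set belongs to
    both.\<close>
  define d where "d = (\<lambda>Q. if Q \<in> P then c Q else c' Q)"
  have stars: "\<forall>Q\<in>P \<union> P'. is_star R B (d Q) Q" using P(5) P'(5) unfolding d_def by auto
  have "star_edges P d = star_edges P c"
    unfolding star_edges_UN d_def by (intro SUP_cong) auto
  moreover have "star_edges P' d = star_edges P' c'"
    using disj unfolding star_edges_UN d_def by (intro SUP_cong) auto
  moreover have "star_edges (P \<union> P') d = star_edges P d \<union> star_edges P' d"
    unfolding star_edges_UN by blast
  ultimately have edges: "star_edges (P \<union> P') d = star_edges P c \<union> star_edges P' c'" by simp
  have cross: "noncrossing e f \<and> noncrossing f e"
    if "e \<in> star_edges P c" "f \<in> star_edges P' c'" for e f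
  proof -
    have "e \<in> C \<times> C" "f \<in> (S - C) \<times> (S - C)"
      using star_edges_subset[OF P(5)] star_edges_subset[OF P'(5)] that
        Sigma_mono[OF P(3) P(3)] Sigma_mono[OF P'(3) P'(3)] by (meson subsetD)+
    then have "closed_segment (fst e) (snd e) \<inter> closed_segment (fst f) (snd f) = {}"
      by (intro separated_segments_disjoint[OF C(2)]) auto
    then show ?thesis unfolding noncrossing_def by blast
  qed
  have "pairwise noncrossing (star_edges (P \<union> P') d)"
    unfolding edges using P(6) P'(6) cross unfolding pairwise_def by blast
  moreover have "disjoint (P \<union> P')"
    using P(3,4) P'(3,4) by (intro disjoint_union) auto
  moreover have "card (P \<union> P') = k + l" using card_Un_disjoint[OF P(1) P'(1) disj] P(2) P'(2) by simp
  moreover have "\<Union>(P \<union> P') \<subseteq> S" using P(3) P'(3) C(1) by blast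
  ultimately show ?thesis
    unfolding star_packing_def using stars P(1) P'(1) by (intro exI[of _ "P \<union> P'"] exI[of _ d]) auto
qed

text \<open>If the segments met in \<open>z\<close>, the triangle inequality through
  \<open>z\<close> would make the exchanged assignment no longer than the given one. Equality then
  puts \<open>z\<close> on all four segments, and non-collinearity forces both \<open>z = x\<close>
  and \<open>z = x'\<close>.\<close>

lemma shortest_assignment_uncrossed:
  fixes d d' x x' :: "'a :: euclidean_space"
  assumes "dist x d + dist x' d' \<le> dist x d' + dist x' d"
    and "\<not> collinear {d, x, d'}" "\<not> collinear {d, x', d'}" "x \<noteq> x'"
  shows "closed_segment d x \<inter> closed_segment d' x' = {}"
proof (rule ccontr)
  assume "\<not> ?thesis"
  then obtain z where z: "z \<in> closed_segment d x" "z \<in> closed_segment d' x'" by blast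
  have "dist x d = dist x z + dist z d" "dist x' d' = dist x' z + dist z d'"
    using z by (auto simp: between_mem_segment[symmetric] between dist_commute)
  moreover have "dist x d' \<le> dist x z + dist z d'" "dist x' d \<le> dist x' z + dist z d"
    by (rule dist_triangle)+
  ultimately have "dist x d' = dist x z + dist z d'" "dist x' d = dist x' z + dist z d"
    using assms(1) by linarith+
  then have z': "z \<in> closed_segment x d'" "z \<in> closed_segment x' d"
    by (auto simp: between_mem_segment[symmetric] between)
  have "z \<in> closed_segment d x \<inter> closed_segment x d'" using z z' by blast
  then have "z = x" using Int_closed_segment[of x d d'] assms(2) by auto
  have "z \<in> closed_segment d x' \<inter> closed_segment x' d'"
    using z z' by (simp add: closed_segment_commute)
  then have "z = x'" using Int_closed_segment[of x' d d'] assms(3) by auto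
  then show False using \<open>z = x\<close> assms(4) by simp
qed

text \<open>Among all assignments of three leaves to each center, one of minimal total length has no
  crossings, since exchanging the leaves of two crossing edges shortens it.\<close>

lemma star_packing_one_centered:
  assumes "finite D" "finite L" "card L = 3 * card D" "D \<inter> L = {}"
    and gp: "general_position (D \<union> L)" and "D \<subseteq> R" "L \<subseteq> B"
  shows "star_packing R B (D \<union> L) (card D)"
proof -
  \<comment> \<open>Three slots for each center: an assignment of leaves is a bijection from
    \<open>L\<close> to the slots. Extensionality in \<open>?H\<close> keeps the set of assignments
    finite.\<close>
  let ?T = "D \<times> {..<3::nat}"
  let ?H = "{h \<in> L \<rightarrow>\<^sub>E ?T. bij_betw h L ?T}"
  let ?cost = "\<lambda>h. \<Sum>x\<in>L. dist x (fst (h x) :: point)"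
  have "card L = card ?T" using assms(3) by (simp add: card_cartesian_product)
  then have "\<exists>h. bij_betw h L ?T" using assms(1,2) by (intro finite_same_card_bij) auto
  then obtain h0 where h0: "bij_betw h0 L ?T" ..
  then have "bij_betw (restrict h0 L) L ?T"
    using bij_betw_cong[of L "restrict h0 L" h0 ?T] by simp
  moreover have "restrict h0 L \<in> L \<rightarrow>\<^sub>E ?T" using bij_betwE[OF h0] by auto
  ultimately have "restrict h0 L \<in> ?H" by blast
  moreover have "finite (L \<rightarrow>\<^sub>E ?T)" using assms(1,2) by (intro finite_PiE) auto
  then have "finite ?H" by simp
  moreover have "?H \<noteq> {}" using calculation by blast
  ultimately obtain h where h: "h \<in> ?H" "\<And>h'. h' \<in> ?H \<Longrightarrow> ?cost h \<le> ?cost h'"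
    using finite_obtains_minimizer[of ?H ?cost] by blast
  define f where "f = (\<lambda>x. fst (h x))"
  have bij: "bij_betw h L ?T" using h(1) by simp
  have fD: "f x \<in> D" if "x \<in> L" for x using bij_betwE[OF bij] that unfolding f_def by auto
  have nc: "\<not> collinear {p, q, s}"
    if "p \<in> D \<union> L" "q \<in> D \<union> L" "s \<in> D \<union> L" "p \<noteq> q" "p \<noteq> s" "q \<noteq> s" for p q s
    using general_position_not_collinear[OF gp that] .
  have uncrossed: "closed_segment (f x) x \<inter> closed_segment (f y) y = {}"
    if xy: "x \<in> L" "y \<in> L" "x \<noteq> y" "f x \<noteq> f y" for x y
  proof -
    \<comment> \<open>The competitor in which \<open>x\<close> and \<open>y\<close> trade slots; all
      other terms of the cost agree.\<close>
    let ?h = "h \<circ> Transposition.transpose x y"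
    have "bij_betw (Transposition.transpose x y) L L"
      using xy by (intro bij_betwI[of _ _ _ "Transposition.transpose x y"]) (auto simp: Transposition.transpose_def)
    then have "bij_betw ?h L ?T" using bij bij_betw_trans by blast
    moreover have "?h \<in> L \<rightarrow>\<^sub>E ?T" using h(1) xy by (auto simp: PiE_iff extensional_def Transposition.transpose_def)
    ultimately have le: "?cost h \<le> ?cost ?h" using h(2) by blast
    have split: "sum g L = g x + (g y + sum g (L - {x} - {y}))" for g :: "point \<Rightarrow> real"
      using xy assms(2) by (simp add: sum.remove)
    have "(\<Sum>z\<in>L - {x} - {y}. dist z (fst (?h z))) = (\<Sum>z\<in>L - {x} - {y}. dist z (fst (h z)))"
      by (rule sum.cong) (auto simp: Transposition.transpose_def)
    then have "dist x (f x) + dist y (f y) \<le> dist x (f y) + dist y (f x)"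
      using le unfolding split f_def by simp
    moreover have "f x \<in> D" "f y \<in> D" "x \<notin> D" "y \<notin> D" using fD xy assms(4) by auto
    then have "\<not> collinear {f x, x, f y}" "\<not> collinear {f x, y, f y}"
      using xy(1,2,4) by (intro nc; force)+
    ultimately show ?thesis using xy by (intro shortest_assignment_uncrossed) auto
  qed
  define star where "star = (\<lambda>d. insert d {x \<in> L. f x = d})"
  \<comment> \<open>The center is recovered as the only point of \<open>D\<close> in the
    star.\<close>
  define c where "c = (\<lambda>Q. SOME d. d \<in> Q \<inter> D)"
  have star_D: "star d \<inter> D = {d}" if "d \<in> D" for d using that assms(4) unfolding star_def by auto
  have c_star: "c (star d) = d" if "d \<in> D" for d unfolding c_def star_D[OF that] by simp
  have inj: "inj_on star D" using c_star by (metis inj_onI)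
  have card_fiber: "card {x \<in> L. f x = d} = 3" if "d \<in> D" for d
  proof -
    have "bij_betw h {x \<in> L. f x = d} ({d} \<times> {..<3})"
      using bij that unfolding bij_betw_def f_def
      by (auto simp: inj_on_def image_iff set_eq_iff) (metis fst_conv)+
    then show ?thesis using bij_betw_same_card by (fastforce simp: card_cartesian_product)
  qed
  have "is_star R B (c Q) Q" if "Q \<in> star ` D" for Q
  proof -
    obtain d where d: "d \<in> D" "Q = star d" using \<open>Q \<in> star ` D\<close> by blast
    have "d \<notin> {x \<in> L. f x = d}" using d assms(4) by blast
    then have "card Q = 4" using card_fiber[OF d(1)] assms(2) unfolding d(2) star_def by simp
    moreover have "Q - {d} \<subseteq> B" using assms(7) unfolding d(2) star_def by blast
    ultimately show ?thesis unfolding is_star_def d(2) c_star[OF d(1)]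
      using d assms(6) unfolding star_def by auto
  qed
  moreover have "pairwise noncrossing (star_edges (star ` D) c)"
  proof (rule pairwiseI)
    have edge: "\<exists>x\<in>L. e = (f x, x)" if "e \<in> star_edges (star ` D) c" for e
    proof -
      obtain d x where "d \<in> D" "x \<in> star d" "x \<noteq> d" "e = (d, x)"
        using \<open>e \<in> _\<close> c_star unfolding star_edges_def by auto
      then show ?thesis unfolding star_def by auto
    qed
    fix e e' assume "e \<in> star_edges (star ` D) c" "e' \<in> star_edges (star ` D) c" "e \<noteq> e'"
    then obtain x y where xy: "x \<in> L" "y \<in> L" "x \<noteq> y" "e = (f x, x)" "e' = (f y, y)"
      using edge by metis
    show "noncrossing e e'"
    proof (cases "f x = f y")
      case False
      then show ?thesis using uncrossed[of x y] xy unfolding noncrossing_def by auto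
    next
      case True
      \<comment> \<open>Two edges of one star meet only in the center, as center and leaves are not
        collinear.\<close>
      have "f x \<in> D" using fD xy by blast
      then have "\<not> collinear {x, f x, y}" using xy assms(4) by (intro nc) auto
      then have "closed_segment x (f x) \<inter> closed_segment (f x) y = {f x}"
        using Int_closed_segment[of "f x" x y] by blast
      then show ?thesis using True xy unfolding noncrossing_def
        by (auto simp: closed_segment_commute)
    qed
  qed
  moreover have "disjoint (star ` D)"
  proof (rule disjointI)
    fix Q Q' assume "Q \<in> star ` D" "Q' \<in> star ` D" "Q \<noteq> Q'"
    then obtain d d' where "d \<in> D" "d' \<in> D" "Q = star d" "Q' = star d'" "d \<noteq> d'" by auto
    then show "Q \<inter> Q' = {}" using assms(4) unfolding star_def by auto
  qed
  moreover have "\<Union>(star ` D) \<subseteq> D \<union> L" unfolding star_def by auto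
  ultimately show ?thesis
    unfolding star_packing_def using assms(1) card_image[OF inj]
    by (intro exI[of _ "star ` D"] exI[of _ c]) auto
qed

lemma card_K13_coverable_of_packing:
  assumes "star_packing R B S k"
  obtains X where "X \<subseteq> S" "K13_coverable R B X" "card X = 4 * k"
proof -
  obtain P c where P: "finite P" "card P = k" "\<Union>P \<subseteq> S" "disjoint P"
    "\<forall>Q\<in>P. is_star R B (c Q) Q" "pairwise noncrossing (star_edges P c)"
    using assms unfolding star_packing_def by blast
  have card4: "card Q = 4" "finite Q" if "Q \<in> P" for Q
  proof -
    show "card Q = 4" using P(5) that unfolding is_star_def by blast
    \<comment> \<open>An infinite set has \<open>card\<close> 0.\<close>
    then show "finite Q" by (metis card.infinite zero_neq_numeral)
  qed
  have "{} \<notin> P" using card4 by fastforce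
  then have "partition_on (\<Union>P) P" using P(4) by (simp add: partition_on_def)
  then have "K13_coverable R B (\<Union>P)" unfolding K13_coverable_def using P(5,6) by blast
  moreover have "card (\<Union>P) = sum card P"
    using P(4) card4(2) by (intro card_Union_disjoint) (auto simp: disjoint_def pairwise_def disjnt_def)
  then have "card (\<Union>P) = 4 * k" using card4(1) P(2) by simp
  ultimately show ?thesis using that P(3) by blast
qed

section \<open>Sets of nine and twenty-seven points\<close>

lemma card_Int_Diff:
  assumes "finite S" "C \<subseteq> S"
  shows "card (C \<inter> R) + card ((S - C) \<inter> R) = card (S \<inter> R)"
proof -
  have "S \<inter> R = (C \<inter> R) \<union> ((S - C) \<inter> R)" using assms(2) by blast
  moreover have "finite C" using assms finite_subset by blast
  moreover have "(C \<inter> R) \<inter> ((S - C) \<inter> R) = {}" by blast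
  ultimately show ?thesis
    using assms(1) card_Un_disjoint[of "C \<inter> R" "(S - C) \<inter> R"] by simp
qed

lemma card_sweep_append:
  "sweep (xs @ ys) \<Longrightarrow> card (set (xs @ ys) \<inter> R) = card (set xs \<inter> R) + card (set ys \<inter> R)"
proof -
  assume "sweep (xs @ ys)"
  then have "(set xs \<inter> R) \<inter> (set ys \<inter> R) = {}" using sweep_distinct by fastforce
  then show ?thesis using card_Un_disjoint[of "set xs \<inter> R" "set ys \<inter> R"]
    by (simp add: Int_Un_distrib2)
qed

text \<open>The first and the last \<open>m\<close> points of a sweep. The
  \<open>card S - 2 * m\<close> points between them account for the slack in the second bound, which
  is written without subtraction.\<close>

lemma opposite_cuts:
  assumes "finite S" "2 * m \<le> card S"
  obtains C D where "cut S C" "cut S D" "card C = m" "card D = m"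
    "card (C \<inter> R) + card (D \<inter> R) \<le> card (S \<inter> R)"
    "card (S \<inter> R) + 2 * m \<le> card (C \<inter> R) + card (D \<inter> R) + card S"
proof -
  obtain xs where xs: "sweep xs" "set xs = S" using exists_sweep[OF assms(1)] .
  have len: "length xs = card S" using xs sweep_distinct distinct_card by metis
  define a b c where "a = take m xs" and "b = take (card S - 2 * m) (drop m xs)"
    and "c = drop (card S - m) xs"
  have "drop (card S - 2 * m) (drop m xs) = c"
    using assms(2) unfolding c_def by (simp add: mult_2)
  then have "xs = a @ b @ c" unfolding a_def b_def by (metis append_take_drop_id)
  then have abc: "xs = a @ b @ c" "length a = m" "length c = m" "length b = card S - 2 * m"
    using len assms(2) unfolding a_def b_def c_def by auto
  have sw: "sweep (a @ (b @ c))" "sweep ((a @ b) @ c)" using xs(1) abc(1) by auto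
  have dist: "distinct a" "distinct c" "distinct b" using sweep_distinct[OF sw(1)] by auto
  have sum: "card (S \<inter> R) = card (set a \<inter> R) + card (set b \<inter> R) + card (set c \<inter> R)"
    using card_sweep_append[OF sw(1), of R] card_sweep_append[OF sweep_append(2)[OF sw(1)], of R]
      xs(2) abc(1) by simp
  have "card (set b \<inter> R) \<le> card (set b)" by (intro card_mono) auto
  then have "card (set b \<inter> R) \<le> card S - 2 * m" using dist abc distinct_card by metis
  then have "card (S \<inter> R) + 2 * m \<le> card (set a \<inter> R) + card (set c \<inter> R) + card S"
    using sum assms(2) by linarith
  moreover have "cut S (set a)" "cut S (set c)"
    using sweep_cut(1)[OF sw(1)] sweep_cut(2)[OF sw(2)] xs(2) abc(1) by auto
  moreover have "card (set a) = m" "card (set c) = m"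
    using distinct_card[OF dist(1)] distinct_card[OF dist(2)] abc by simp_all
  moreover have "card (set a \<inter> R) + card (set c \<inter> R) \<le> card (S \<inter> R)" using sum by linarith
  ultimately show ?thesis using that[of "set a" "set c"] by blast
qed

section \<open>Colour counts that guarantee packings\<close>

locale bicoloured =
  fixes R B :: "point set"
  assumes finite_R: "finite R" and finite_B: "finite B" and disjoint_RB: "R \<inter> B = {}"
    and general_position_RB: "general_position (R \<union> B)"
begin

text \<open>Lets every result be applied with the colours exchanged.\<close>

lemma bicoloured_swap: "bicoloured B R"
  using finite_R finite_B disjoint_RB general_position_RB
  by unfold_locales (auto simp: Un_commute)

lemma finite_subset_RB: "S \<subseteq> R \<union> B \<Longrightarrow> finite S"
  using finite_R finite_B finite_subset by blast

lemma general_position_subset_RB: "S \<subseteq> R \<union> B \<Longrightarrow> general_position S"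
  using general_position_RB general_position_subset by blast

lemma card_colours:
  assumes "S \<subseteq> R \<union> B"
  shows "card S = card (S \<inter> R) + card (S \<inter> B)"
proof -
  have "S = (S \<inter> R) \<union> (S \<inter> B)" "(S \<inter> R) \<inter> (S \<inter> B) = {}" using assms disjoint_RB by auto
  then show ?thesis using card_Un_disjoint finite_subset_RB[OF assms] by (metis finite_Int)
qed

text \<open>Any \<open>j\<close> red centers and \<open>3 * j\<close> blue leaves will do, so only
  the counts matter.\<close>

lemma packing_red_centers:
  assumes "S \<subseteq> R \<union> B" "j \<le> card (S \<inter> R)" "3 * j \<le> card (S \<inter> B)"
  shows "star_packing R B S j"
proof -
  obtain D where D: "D \<subseteq> S \<inter> R" "card D = j" "finite D"
    using obtain_subset_with_card_n[OF assms(2)] .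
  obtain L where L: "L \<subseteq> S \<inter> B" "card L = 3 * j" "finite L"
    using obtain_subset_with_card_n[OF assms(3)] .
  have "general_position (D \<union> L)" using D L by (intro general_position_subset_RB) auto
  then have "star_packing R B (D \<union> L) (card D)"
    using D L disjoint_RB by (intro star_packing_one_centered) auto
  then show ?thesis using D L star_packing_mono by blast
qed

lemma packing_blue_centers:
  assumes "S \<subseteq> R \<union> B" "j \<le> card (S \<inter> B)" "3 * j \<le> card (S \<inter> R)"
  shows "star_packing R B S j"
  using bicoloured.packing_red_centers[OF bicoloured_swap] assms star_packing_swap
  by (simp add: Un_commute)

text \<open>Supplies all size and colour counts of the two sides as assumptions, so that
  applications reduce to arithmetic.\<close>

lemma packing_cut:
  assumes "S \<subseteq> R \<union> B" "cut S C" "k = i + j"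
    and "\<lbrakk>C \<subseteq> R \<union> B; card C = card (C \<inter> R) + card (C \<inter> B)\<rbrakk> \<Longrightarrow> star_packing R B C i"
    and "\<lbrakk>S - C \<subseteq> R \<union> B; card (S - C) = card ((S - C) \<inter> R) + card ((S - C) \<inter> B);
      card C + card (S - C) = card S; card (C \<inter> R) + card ((S - C) \<inter> R) = card (S \<inter> R);
      card (C \<inter> B) + card ((S - C) \<inter> B) = card (S \<inter> B)\<rbrakk> \<Longrightarrow> star_packing R B (S - C) j"
  shows "star_packing R B S k"
proof -
  have fin: "finite S" using finite_subset_RB[OF assms(1)] .
  have C: "C \<subseteq> S" using cut_subset[OF assms(2)] .
  have "C \<subseteq> R \<union> B" "S - C \<subseteq> R \<union> B" using C assms(1) by auto
  \<comment> \<open>Counting with \<open>UNIV\<close> as colour class yields the sizes.\<close>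
  then have "star_packing R B C i" "star_packing R B (S - C) j"
    using assms(4,5) card_colours card_Int_Diff[OF fin C, of R] card_Int_Diff[OF fin C, of B]
      card_Int_Diff[OF fin C, of UNIV] by auto
  then show ?thesis using star_packing_cut[OF assms(2)] assms(3) by simp
qed

text \<open>If no line cuts off four points with an odd number of red ones, then every line cutting off
  four points cuts off two red ones. When the rotation exchanges a blue point \<open>x\<close> for a point \<open>y\<close>,
  then \<open>y\<close> is blue too, and the five points on or below the line contain two red ones. So the other
  four points contain three, a contradiction.\<close>

lemma packing_five_four:
  assumes S: "S \<subseteq> R \<union> B" "card S = 9" "card (S \<inter> R) = 5"
  shows "star_packing R B S 2"
proof -
  note fin = finite_subset_RB[OF S(1)] and gp = general_position_subset_RB[OF S(1)]
  \<comment> \<open>One red point among the four leaves four red and one blue; three leave two red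
    and three blue. Both sides then contain a star.\<close>
  have one: ?thesis if E: "cut S E" "card E = 4" "card (E \<inter> R) = 1" for E
  proof (rule packing_cut[OF S(1) E(1)])
    show "(2::nat) = 1 + 1" by simp
    show "star_packing R B E 1" if "E \<subseteq> R \<union> B" "card E = card (E \<inter> R) + card (E \<inter> B)"
      using that E by (intro packing_red_centers) auto
    show "star_packing R B (S - E) 1" if "S - E \<subseteq> R \<union> B"
      "card (S - E) = card ((S - E) \<inter> R) + card ((S - E) \<inter> B)" "card E + card (S - E) = card S"
      "card (E \<inter> R) + card ((S - E) \<inter> R) = card (S \<inter> R)"
      using that E S by (intro packing_blue_centers) auto
  qed
  have three: ?thesis if E: "cut S E" "card E = 4" "card (E \<inter> R) = 3" for E
  proof (rule packing_cut[OF S(1) E(1)])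
    show "(2::nat) = 1 + 1" by simp
    show "star_packing R B E 1" if "E \<subseteq> R \<union> B" "card E = card (E \<inter> R) + card (E \<inter> B)"
      using that E by (intro packing_blue_centers) auto
    show "star_packing R B (S - E) 1" if "S - E \<subseteq> R \<union> B"
      "card (S - E) = card ((S - E) \<inter> R) + card ((S - E) \<inter> B)" "card E + card (S - E) = card S"
      "card (E \<inter> R) + card ((S - E) \<inter> R) = card (S \<inter> R)"
      using that E S by (intro packing_red_centers) auto
  qed
  show ?thesis
  proof (rule ccontr)
    assume "\<not> ?thesis"
    then have no: "card (E \<inter> R) \<noteq> 1" "card (E \<inter> R) \<noteq> 3" if "cut S E" "card E = 4" for E
      using one three that by blast+
    obtain C D where CD: "cut S C" "cut S D" "card C = 4" "card D = 4"
      "card (C \<inter> R) + card (D \<inter> R) \<le> card (S \<inter> R)"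
      "card (S \<inter> R) + 2 * 4 \<le> card (C \<inter> R) + card (D \<inter> R) + card S"
      using opposite_cuts[OF fin, of 4 R] S by auto
    have skip: "v < card (E \<inter> R) \<or> card (F \<inter> R) < v"
      if "cut S E" "cut S F" "card E = 4" "card F = 4" "v = 1 \<or> v = 3" for E F v
      using cut_intermediate_value[OF fin gp that(1-4), of R v] no that(5) not_less by metis
    define i j where "i = card (C \<inter> R)" and "j = card (D \<inter> R)"
    \<comment> \<open>Only one point lies outside the two cuts, so \<open>i + j\<close> is 4 or 5.
      Odd counts 1 and 3 are excluded, and passing between 0 and 4 or 5 would meet the value 1; only
      \<open>i = j = 2\<close> remains.\<close>
    have "i + j \<le> 5" "4 \<le> i + j" "i \<noteq> 1" "i \<noteq> 3" "j \<noteq> 1" "j \<noteq> 3" "1 < i \<or> j < 1" "1 < j \<or> i < 1"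
      using CD(5,6) S no[OF CD(1,3)] no[OF CD(2,4)] skip[OF CD(1,2,3,4), of 1]
        skip[OF CD(2,1,4,3), of 1]
      unfolding i_def j_def by auto
    then have "i = 2" by presburger
    then have CD2: "card (C \<inter> R) = 2" unfolding i_def .
    have two: "card (E \<inter> R) = 2" if "cut S E" "card E = 4" for E
    proof -
      have "1 < card (E \<inter> R) \<or> card (C \<inter> R) < 1" "3 < card (C \<inter> R) \<or> card (E \<inter> R) < 3"
        using skip[OF that(1) CD(1) that(2) CD(3), of 1] skip[OF CD(1) that(1) CD(3) that(2), of 3]
        by auto
      then show ?thesis using CD2 by linarith
    qed
    have "finite C" "C \<subseteq> S" using cut_subset[OF CD(1)] fin finite_subset by auto
    then have "card (C \<inter> B) = 2" using card_colours[of C] CD(3) CD2 S(1) by auto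
    then obtain x where x: "x \<in> C" "x \<in> B" by (metis Int_iff card.empty equals0I zero_neq_numeral)
    \<comment> \<open>With \<open>{x}\<close> as colour class, one of two opposite cuts avoids
      \<open>x\<close>.\<close>
    have "2 * 4 \<le> card S" using S by simp
    from opposite_cuts[OF fin this, of "{x}"]
    obtain C' E' where CE: "cut S C'" "cut S E'" "card C' = 4" "card E' = 4"
      "card (C' \<inter> {x}) + card (E' \<inter> {x}) \<le> card (S \<inter> {x})" by metis
    have "card (S \<inter> {x}) \<le> 1" using card_mono[of "{x}" "S \<inter> {x}"] by simp
    then have "x \<notin> C' \<or> x \<notin> E'" using CE(5) by (auto simp: Int_insert_right split: if_splits)
    then obtain D' where D': "cut S D'" "card D' = 4" "x \<notin> D'" using CE by blast
    \<comment> \<open>Rotating with the predicate \<open>x \<in> E\<close> makes the outgoing point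
      \<open>p\<close> the blue point \<open>x\<close> itself.\<close>
    have "card C = card D'" using CD D' by simp
    from rotate_cut[where Q = "\<lambda>E. x \<in> E", OF fin gp CD(1) D'(1) this x(1) D'(3)]
    obtain A p q where A: "p \<notin> A" "q \<notin> A" "p \<noteq> q" "cut S (insert p A)" "cut S (insert q A)"
      "cut S (insert p (insert q A))" "Suc (card A) = card D'" "x \<in> insert p A" "x \<notin> insert q A"
      by metis
    have "p = x" using A by auto
    have finA: "finite A" and q: "q \<in> S" using cut_subset[OF A(5)] fin finite_subset by auto
    have cards: "card (insert p A) = 4" "card (insert q A) = 4" using finA A D' by auto
    have red2: "card (insert p A \<inter> R) = 2" "card (insert q A \<inter> R) = 2"
      using two A(4,5) cards by auto
    have "p \<notin> R" using x \<open>p = x\<close> disjoint_RB by auto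
    then have "card (insert p (insert q A) \<inter> R) = 2"
      using red2 A finA by (simp add: card_insert_Int)
    moreover have "card (insert p (insert q A)) = 5" using cards A finA by simp
    moreover have "insert p (insert q A) \<subseteq> S" using cut_subset[OF A(6)] .
    ultimately have "card (S - insert p (insert q A)) = 4"
      "card ((S - insert p (insert q A)) \<inter> R) = 3"
      using card_Int_Diff[OF fin, of "insert p (insert q A)" UNIV]
        card_Int_Diff[OF fin, of "insert p (insert q A)" R] S by auto
    then show False using no(2) cut_Diff[OF A(6)] by blast
  qed
qed

text \<open>Up to three or from six red points on, two centers of the rarer colour find six leaves;
  only the split into four and five needs geometry.\<close>

lemma packing_nine:
  assumes S: "S \<subseteq> R \<union> B" "card S = 9" "2 \<le> card (S \<inter> R)" "card (S \<inter> R) \<le> 7"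
  shows "star_packing R B S 2"
proof -
  have sum: "card (S \<inter> R) + card (S \<inter> B) = 9" using card_colours S by simp
  consider "card (S \<inter> R) \<le> 3" | "card (S \<inter> R) = 4" | "card (S \<inter> R) = 5" | "card (S \<inter> R) \<ge> 6"
    by linarith
  then show ?thesis
  proof cases
    case 1
    then show ?thesis using S sum by (intro packing_red_centers) auto
  next
    case 2
    then have "star_packing B R S 2"
      using S sum by (intro bicoloured.packing_five_four[OF bicoloured_swap]) auto
    then show ?thesis by (rule star_packing_swap)
  next
    case 3
    then show ?thesis using S packing_five_four by blast
  next
    case 4
    then show ?thesis using S sum by (intro packing_blue_centers) auto
  qed
qed

text \<open>Opposite cuts of half the points share out all red points, so their counts lie on both
  sides of one half.\<close>

lemma halving_cut:
  assumes "S \<subseteq> R \<union> B" "card S = 2 * m"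
  obtains E where "cut S E" "card E = m" "card (E \<inter> R) = card (S \<inter> R) div 2"
proof -
  note fin = finite_subset_RB[OF assms(1)] and gp = general_position_subset_RB[OF assms(1)]
  obtain C D where CD: "cut S C" "cut S D" "card C = m" "card D = m"
    "card (C \<inter> R) + card (D \<inter> R) \<le> card (S \<inter> R)"
    "card (S \<inter> R) + 2 * m \<le> card (C \<inter> R) + card (D \<inter> R) + card S"
    using opposite_cuts[OF fin, of m R] assms by auto
  then have "card (C \<inter> R) + card (D \<inter> R) = card (S \<inter> R)" using assms by simp
  then consider "card (C \<inter> R) \<le> card (S \<inter> R) div 2" "card (S \<inter> R) div 2 \<le> card (D \<inter> R)"
    | "card (D \<inter> R) \<le> card (S \<inter> R) div 2" "card (S \<inter> R) div 2 \<le> card (C \<inter> R)" by linarith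
  then show ?thesis
  proof cases
    case 1
    then show ?thesis using cut_intermediate_value[OF fin gp CD(1-4)] that by metis
  next
    case 2
    then show ?thesis using cut_intermediate_value[OF fin gp CD(2,1,4,3)] that by metis
  qed
qed

text \<open>Here every line that cuts off nine points cuts off at most one red point, so the nine
  middle points of the sweep are almost all red.\<close>

lemma packing_red_core:
  assumes sw: "sweep (a @ m @ w @ z)" and len: "length a = 9" "length m = 4" "length w = 5" "length z = 9"
    and sub: "set (a @ m @ w @ z) \<subseteq> R \<union> B"
    and red: "card (set (a @ m @ w @ z) \<inter> R) = 10 \<or> card (set (a @ m @ w @ z) \<inter> R) = 11"
    and core: "card (set a \<inter> R) = 1" "card (set m \<inter> R) = 4" "card (set z \<inter> R) \<le> 1"
  shows "star_packing R B (set (a @ m @ w @ z)) 6"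
proof -
  \<comment> \<open>Thirteen points with five red ones are split from fourteen with five or six;
    each part yields three stars.\<close>
  let ?S = "set (a @ m @ w @ z)" and ?L = "set (a @ m)" and ?W = "set (w @ z)"
  have sw1: "sweep ((a @ m) @ (w @ z))" using sw by simp
  have swL: "sweep (a @ m)" and swW: "sweep (w @ z)" using sweep_append[OF sw1] .
  have cutS: "cut ?S ?L" using sweep_cut(1)[OF sw1] by simp
  have diff: "?S - ?L = ?W" using sweep_distinct[OF sw1] by auto
  have subL: "?L \<subseteq> R \<union> B" and subW: "?W \<subseteq> R \<union> B" using sub by auto
  have cardL: "card ?L = 13" "card ?W = 14" "card (set m) = 4" "card (set w) = 5"
    using sweep_distinct[OF swL] sweep_distinct[OF swW] len
    by (simp_all only: distinct_card length_append distinct_append)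
  have redL: "card (?L \<inter> R) = 5" using card_sweep_append[OF swL, of R] core by simp
  have redW: "card (?S \<inter> R) = 5 + card (?W \<inter> R)"
    using card_sweep_append[OF sw1, of R] redL by simp
  have packL: "star_packing R B ?L 3"
  proof -
    have "sweep (take 4 a @ (drop 4 a @ m))" using swL by (metis append.assoc append_take_drop_id)
    then have "cut (set (take 4 a @ (drop 4 a @ m))) (set (take 4 a))" by (rule sweep_cut)
    moreover have "take 4 a @ (drop 4 a @ m) = a @ m" by (metis append.assoc append_take_drop_id)
    ultimately have c1: "cut ?L (set (take 4 a))" by simp
    have "distinct (take 4 a)" using sweep_distinct[OF swL] by simp
    then have card1: "card (set (take 4 a)) = 4" using len by (simp add: distinct_card)
    have "card (set (take 4 a) \<inter> R) \<le> card (set a \<inter> R)"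
      by (intro card_mono) (auto dest: in_set_takeD)
    then have le1: "card (set (take 4 a) \<inter> R) \<le> 1" using core by simp
    have ge1: "1 \<le> card (set m \<inter> R)" using core by simp
    \<comment> \<open>The first four points have at most one red and the block \<open>m\<close> has
      four. One red point in \<open>E\<close> leaves nine points with four red ones.\<close>
    obtain E where E: "cut ?L E" "card E = 4" "card (E \<inter> R) = 1"
      using cut_intermediate_value[OF finite_subset_RB[OF subL] general_position_subset_RB[OF subL]
          c1 sweep_cut(2)[OF swL] card1 cardL(3) le1 ge1] .
    show ?thesis
    proof (rule packing_cut[OF subL E(1)])
      show "(3::nat) = 1 + 2" by simp
      show "star_packing R B E 1" if "E \<subseteq> R \<union> B" "card E = card (E \<inter> R) + card (E \<inter> B)"
        using that E by (intro packing_red_centers) auto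
      show "star_packing R B (?L - E) 2" if "?L - E \<subseteq> R \<union> B"
        "card (?L - E) = card ((?L - E) \<inter> R) + card ((?L - E) \<inter> B)" "card E + card (?L - E) = card ?L"
        "card (E \<inter> R) + card ((?L - E) \<inter> R) = card (?L \<inter> R)"
        using that E cardL redL by (intro packing_nine) linarith+
    qed
  qed
  have packW: "star_packing R B ?W 3"
    using red
  proof
    \<comment> \<open>Five red centers face nine blue leaves, enough for three stars.\<close>
    assume "card (?S \<inter> R) = 10"
    then have "card (?W \<inter> R) = 5" using redW by simp
    then show ?thesis using card_colours[OF subW] cardL by (intro packing_red_centers[OF subW]) linarith+
  next
    assume "card (?S \<inter> R) = 11"
    then have redW6: "card (?W \<inter> R) = 6" using redW by simp
    have "sweep ((w @ take 4 z) @ drop 4 z)" using swW by (metis append.assoc append_take_drop_id)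
    then have "cut (set ((w @ take 4 z) @ drop 4 z)) (set (drop 4 z))" by (rule sweep_cut)
    moreover have "(w @ take 4 z) @ drop 4 z = w @ z" by (metis append.assoc append_take_drop_id)
    ultimately have c1: "cut ?W (set (drop 4 z))" by simp
    have "distinct (drop 4 z)" using sweep_distinct[OF swW] by simp
    then have card1: "card (set (drop 4 z)) = 5" using len by (simp add: distinct_card)
    have "card (set (drop 4 z) \<inter> R) \<le> card (set z \<inter> R)"
      by (intro card_mono) (auto dest: in_set_dropD)
    then have le1: "card (set (drop 4 z) \<inter> R) \<le> 4" using core by simp
    have ge1: "1 \<le> card (set w \<inter> R)" using card_sweep_append[OF swW, of R] redW6 core by simp
    \<comment> \<open>Five points with one to four red ones contain a star, and the other nine keep
      two to five red ones.\<close>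
    obtain E where E: "cut ?W E" "card E = 5" "1 \<le> card (E \<inter> R)" "card (E \<inter> R) \<le> 4"
      using cut_intermediate_range[OF finite_subset_RB[OF subW] general_position_subset_RB[OF subW]
          c1 sweep_cut(1)[OF swW] card1 cardL(4) le1 ge1] by auto
    show ?thesis
    proof (rule packing_cut[OF subW E(1)])
      show "(3::nat) = 1 + 2" by simp
      show "star_packing R B E 1" if "E \<subseteq> R \<union> B" "card E = card (E \<inter> R) + card (E \<inter> B)"
      proof (cases "card (E \<inter> R) \<le> 2")
        case True
        then show ?thesis using that E by (intro packing_red_centers) linarith+
      next
        case False
        then show ?thesis using that E by (intro packing_blue_centers) linarith+
      qed
      show "star_packing R B (?W - E) 2" if "?W - E \<subseteq> R \<union> B"
        "card (?W - E) = card ((?W - E) \<inter> R) + card ((?W - E) \<inter> B)" "card E + card (?W - E) = card ?W"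
        "card (E \<inter> R) + card ((?W - E) \<inter> R) = card (?W \<inter> R)"
        using that E cardL redW6 by (intro packing_nine) linarith+
    qed
  qed
  show ?thesis using star_packing_cut[OF cutS packL, of 3] packW diff by simp
qed

text \<open>The bounds are twice those for nine points, so both roundings of half the red count stay
  in range.\<close>

lemma packing_eighteen:
  assumes S: "S \<subseteq> R \<union> B" "card S = 18" "4 \<le> card (S \<inter> R)" "card (S \<inter> R) \<le> 14"
  shows "star_packing R B S 4"
proof -
  have "card S = 2 * 9" using S by simp
  then obtain E where E: "cut S E" "card E = 9" "card (E \<inter> R) = card (S \<inter> R) div 2"
    using halving_cut[OF S(1)] by metis
  show ?thesis
  proof (rule packing_cut[OF S(1) E(1)])
    show "(4::nat) = 2 + 2" by simp
    show "star_packing R B E 2" if "E \<subseteq> R \<union> B"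
      using that E S by (intro packing_nine) auto
    show "star_packing R B (S - E) 2" if "S - E \<subseteq> R \<union> B" "card E + card (S - E) = card S"
      "card (E \<inter> R) + card ((S - E) \<inter> R) = card (S \<inter> R)"
      using that E S by (intro packing_nine) linarith+
  qed
qed

text \<open>A cut of nine points with two to six red ones leaves eighteen points with four to
  eleven. If no such cut exists, all cuts of nine points have at most one red point and the red ones
  concentrate in the middle.\<close>

lemma packing_twenty_seven:
  assumes S: "S \<subseteq> R \<union> B" "card S = 27" "10 \<le> card (S \<inter> R)" "card (S \<inter> R) \<le> 13"
  shows "star_packing R B S 6"
proof -
  note fin = finite_subset_RB[OF S(1)] and gp = general_position_subset_RB[OF S(1)]
  show ?thesis
  proof (cases "\<exists>D. cut S D \<and> card D = 9 \<and> 2 \<le> card (D \<inter> R)")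
    case True
    then obtain D where D: "cut S D" "card D = 9" "2 \<le> card (D \<inter> R)" by blast
    have "2 * 9 \<le> card S" using S by simp
    from opposite_cuts[OF fin this, of R]
    obtain C C' where C: "cut S C" "cut S C'" "card C = 9" "card C' = 9"
      "card (C \<inter> R) + card (C' \<inter> R) \<le> card (S \<inter> R)" by metis
    \<comment> \<open>Two disjoint sets share at most 13 red points.\<close>
    then have "card (C \<inter> R) \<le> 6 \<or> card (C' \<inter> R) \<le> 6" using S by linarith
    then obtain C0 where C0: "cut S C0" "card C0 = 9" "card (C0 \<inter> R) \<le> 6" using C by blast
    obtain E where E: "cut S E" "card E = 9" "2 \<le> card (E \<inter> R)" "card (E \<inter> R) \<le> 6"
      using cut_intermediate_range[OF fin gp C0(1) D(1) C0(2) D(2) C0(3) D(3)] by auto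
    show ?thesis
    proof (rule packing_cut[OF S(1) E(1)])
      show "(6::nat) = 2 + 4" by simp
      show "star_packing R B E 2" if "E \<subseteq> R \<union> B"
        using that E by (intro packing_nine) auto
      show "star_packing R B (S - E) 4" if "S - E \<subseteq> R \<union> B" "card E + card (S - E) = card S"
        "card (E \<inter> R) + card ((S - E) \<inter> R) = card (S \<inter> R)"
        using that E S by (intro packing_eighteen) linarith+
    qed
  next
    case False
    then have few: "card (D \<inter> R) \<le> 1" if "cut S D" "card D = 9" for D
      using that by force
    obtain xs where xs: "sweep xs" "set xs = S" using exists_sweep[OF fin] .
    have len: "length xs = 27" using xs sweep_distinct distinct_card S(2) by metis
    define a m y n z where "a = take 9 xs" and "m = take 4 (drop 9 xs)" and "y = take 1 (drop 13 xs)"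
      and "n = take 4 (drop 14 xs)" and "z = drop 18 xs"
    have "xs = take 9 xs @ drop 9 xs" "drop 9 xs = m @ drop 13 xs" "drop 13 xs = y @ drop 14 xs"
      "drop 14 xs = n @ drop 18 xs"
      unfolding m_def y_def n_def
      using append_take_drop_id[of 4 "drop 9 xs"] append_take_drop_id[of 1 "drop 13 xs"]
        append_take_drop_id[of 4 "drop 14 xs"] by (simp_all add: drop_drop)
    then have eq: "xs = a @ m @ y @ n @ z" unfolding a_def z_def by metis
    have lens: "length a = 9" "length m = 4" "length y = 1" "length n = 4" "length z = 9"
      unfolding a_def m_def y_def n_def z_def using len by auto
    have sw1: "sweep (a @ (m @ y @ n @ z))" and sw2: "sweep ((a @ m @ y @ n) @ z)"
      using xs eq by auto
    note sw3 = sweep_append(2)[OF sw1]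
    note sw4 = sweep_append(2)[OF sw3]
    note sw5 = sweep_append(2)[OF sw4]
    have sum: "card (S \<inter> R) = card (set a \<inter> R) + card (set m \<inter> R) + card (set y \<inter> R)
        + card (set n \<inter> R) + card (set z \<inter> R)"
      using card_sweep_append[OF sw1, of R] card_sweep_append[OF sw3, of R]
        card_sweep_append[OF sw4, of R] card_sweep_append[OF sw5, of R] xs(2) eq by simp
    have short: "card (set l \<inter> R) \<le> length l" for l :: "point list"
      using card_mono[of "set l" "set l \<inter> R"] card_length[of l] by simp
    have "cut S (set a)" "cut S (set z)"
      using sweep_cut(1)[OF sw1] sweep_cut(2)[OF sw2] xs(2) eq by auto
    moreover have "card (set a) = 9" "card (set z) = 9"
      using sweep_distinct[OF sw1] lens by (simp_all add: distinct_card)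
    ultimately have ends: "card (set a \<inter> R) \<le> 1" "card (set z \<inter> R) \<le> 1" using few by blast+
    have red: "card (S \<inter> R) = 10 \<or> card (S \<inter> R) = 11"
      using sum short[of m] short[of y] short[of n] ends lens S(3) by linarith
    \<comment> \<open>The blocks hold at most 1 + 4 + 1 + 4 + 1 = 11 red points and at least 10 are
      present, so at most one bound is missed, and by one; the blocks on one of the two sides are
      full.\<close>
    consider "card (set a \<inter> R) = 1" "card (set m \<inter> R) = 4"
      | "card (set z \<inter> R) = 1" "card (set n \<inter> R) = 4"
      using sum short[of m] short[of y] short[of n] ends lens S(3) by linarith
    then show ?thesis
    proof cases
      case 1
      have S_eq: "set (a @ m @ (y @ n) @ z) = S" using eq xs(2) by simp
      have "sweep (a @ m @ (y @ n) @ z)" using sw1 by simp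
      from packing_red_core[OF this, unfolded S_eq] show ?thesis using 1 lens ends red S(1) by simp
    next
      case 2
      \<comment> \<open>The mirror image, with the middle point joined to \<open>m\<close> instead
        of \<open>n\<close>.\<close>
      have "sweep (rev xs)" using sweep_rev[OF xs(1)] .
      then have sw': "sweep (rev z @ rev n @ (rev y @ rev m) @ rev a)" using eq by simp
      have S_eq: "set (rev z @ rev n @ (rev y @ rev m) @ rev a) = S" using eq xs(2) by auto
      from packing_red_core[OF sw', unfolded S_eq] show ?thesis using 2 lens ends red S(1) by simp
    qed
  qed
qed

section \<open>Sets of \<open>9g\<close> points\<close>

lemma packing_multiple_of_nine:
  assumes "S \<subseteq> R \<union> B" "card S = 9 * g" "2 * g \<le> card (S \<inter> R)" "card (S \<inter> R) \<le> 7 * g"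
  shows "star_packing R B S (2 * g)"
  using assms
proof (induction g arbitrary: S rule: less_induct)
  case (less g)
  note S = less.prems
  note fin = finite_subset_RB[OF S(1)] and gp = general_position_subset_RB[OF S(1)]
  have sum: "card (S \<inter> R) + card (S \<inter> B) = 9 * g" using card_colours S by simp
  have split: ?case
    if E: "cut S E" "card E = 9 * k" "2 * k \<le> card (E \<inter> R)" "card (E \<inter> R) \<le> 7 * k"
      and g: "g = k + l" "k > 0" "l > 0"
      and rest: "2 * l + card (E \<inter> R) \<le> card (S \<inter> R)" "card (S \<inter> R) \<le> 7 * l + card (E \<inter> R)"
    for E k l
  proof (rule packing_cut[OF S(1) E(1)])
    show "2 * g = 2 * k + 2 * l" using g by simp
    show "star_packing R B E (2 * k)" if "E \<subseteq> R \<union> B"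
      using that E g by (intro less.IH) auto
    show "star_packing R B (S - E) (2 * l)" if "S - E \<subseteq> R \<union> B" "card E + card (S - E) = card S"
      "card (E \<inter> R) + card ((S - E) \<inter> R) = card (S \<inter> R)"
      using that E g rest S(2) by (intro less.IH) linarith+
  qed
  consider "card (S \<inter> R) \<le> 3 * g" | "6 * g \<le> card (S \<inter> R)"
    | "3 * g < card (S \<inter> R)" "card (S \<inter> R) < 6 * g" by linarith
  then show ?case
  proof cases
    case 1
    then show ?thesis using S sum by (intro packing_red_centers) auto
  next
    case 2
    then show ?thesis using S sum by (intro packing_blue_centers) auto
  next
    case 3
    consider "g = 1" | "g = 3" | k where "g = 2 * k" "k > 0" | k where "g = 2 * k + 1" "k \<ge> 2"
    proof (cases "even g")
      case True
      then show ?thesis using that(3) 3 by (elim evenE) auto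
    next
      case False
      then obtain k where k: "g = 2 * k + 1" by (elim oddE)
      then show ?thesis using that(1,2,4) by (cases "k = 0"; cases "k = 1") auto
    qed
    then show ?thesis
    proof cases
      assume "g = 1"
      then show ?thesis using S packing_nine by simp
    next
      assume "g = 3"
      show ?thesis
      \<comment> \<open>There are 10 to 17 red points here, so otherwise 10 to 13 are blue.\<close>
      proof (cases "card (S \<inter> R) \<le> 13")
        case True
        then show ?thesis using S \<open>g = 3\<close> 3 packing_twenty_seven by simp
      next
        case False
        then have "star_packing B R S 6" using S sum \<open>g = 3\<close> 3
          by (intro bicoloured.packing_twenty_seven[OF bicoloured_swap]) auto
        then show ?thesis using star_packing_swap \<open>g = 3\<close> by simp
      qed
    next
      fix k assume k: "g = 2 * k" "k > 0"
      then have "card S = 2 * (9 * k)" using S by simp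
      then obtain E where "cut S E" "card E = 9 * k" "card (E \<inter> R) = card (S \<inter> R) div 2"
        using halving_cut[OF S(1)] by metis
      then show ?thesis using k S by (intro split[of E k k]) linarith+
    next
      fix k assume k: "g = 2 * k + 1" "k \<ge> 2"
      obtain C D where CD: "cut S C" "cut S D" "card C = 9 * k" "card D = 9 * k"
        "card (C \<inter> R) + card (D \<inter> R) \<le> card (S \<inter> R)"
        "card (S \<inter> R) + 2 * (9 * k) \<le> card (C \<inter> R) + card (D \<inter> R) + card S"
        using opposite_cuts[OF fin, of "9 * k" R] S k by auto
      \<comment> \<open>Nine points lie between the two cuts, whence the 9: \<open>C'\<close> has at
        most half of the red points and \<open>D'\<close> misses half by at most 4.5.\<close>
      obtain C' D' where CD': "cut S C'" "cut S D'" "card C' = 9 * k" "card D' = 9 * k"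
        "2 * card (C' \<inter> R) \<le> card (S \<inter> R)" "card (S \<inter> R) \<le> 2 * card (D' \<inter> R) + 9"
      proof (cases "card (C \<inter> R) \<le> card (D \<inter> R)")
        case True
        show ?thesis by (rule that[OF CD(1-4)]) (use True CD S k in linarith)+
      next
        case False
        show ?thesis by (rule that[OF CD(2,1,4,3)]) (use False CD S k in linarith)+
      qed
      \<comment> \<open>The bounds on the red count of \<open>E\<close> that put both
        \<open>E\<close> and its complement, \<open>9 * (k + 1)\<close> points, in range. Truncation
        in \<open>?a\<close> is absorbed by the \<open>max\<close>. With red counts strictly between
        \<open>3 * g\<close> and \<open>6 * g\<close>, \<open>C'\<close> has at most
        \<open>6 * k + 2\<close> and \<open>D'\<close> at least \<open>3 * k - 2\<close> red points;
        \<open>k \<ge> 2\<close> brings these within \<open>7 * k\<close> and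
        \<open>2 * k\<close>.\<close>
      let ?a = "max (2 * k) (card (S \<inter> R) - (7 * k + 7))"
      let ?b = "min (7 * k) (card (S \<inter> R) - (2 * k + 2))"
      have "card (C' \<inter> R) \<le> ?b" "?a \<le> card (D' \<inter> R)" "?a \<le> ?b"
        using CD'(5,6) 3 k by auto
      from cut_intermediate_range[OF fin gp CD'(1-4) this]
      obtain E where E: "cut S E" "card E = 9 * k" "?a \<le> card (E \<inter> R)" "card (E \<inter> R) \<le> ?b" .
      show ?thesis using E k 3 by (intro split[of E k "k + 1"]) auto
    qed
  qed
qed

end

section \<open>The bound for arbitrary colour counts\<close>

lemma C_set_lower_bound:
  assumes "rb_set r b R B" "b \<le> r" "4 * r \<le> 5 * b" "g = (r + b) div 9"
  shows "8 * g \<le> C_set R B"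
proof -
  have RB: "finite R" "finite B" "card R = r" "card B = b" "R \<inter> B = {}"
    "general_position (R \<union> B)" using assms(1) unfolding rb_set_def by auto
  interpret bicoloured R B using RB by unfold_locales
  have "9 * g \<le> r + b" using assms(4) by simp
  \<comment> \<open>Keep \<open>5 * g\<close> red and \<open>4 * g\<close> blue points, or all red
    ones filled up with blue if there are fewer red. From \<open>4 * r \<le> 5 * b\<close> and
    \<open>9 * g \<le> r + b\<close> follows \<open>4 * g \<le> b\<close>; from
    \<open>b \<le> r\<close>, at least \<open>4.5 * g\<close> red points exist.\<close>
  then have le: "min (5 * g) r \<le> card R" "max (4 * g) (9 * g - r) \<le> card B"
    using assms(2,3) RB by auto
  obtain R' where R': "R' \<subseteq> R" "card R' = min (5 * g) r" "finite R'"
    using obtain_subset_with_card_n[OF le(1)] .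
  obtain B' where B': "B' \<subseteq> B" "card B' = max (4 * g) (9 * g - r)" "finite B'"
    using obtain_subset_with_card_n[OF le(2)] .
  let ?S = "R' \<union> B'"
  have red: "?S \<inter> R = R'" and "R' \<inter> B' = {}" using R' B' RB by auto
  then have "card ?S = card R' + card B'" using R' B' by (intro card_Un_disjoint)
  then have "card ?S = 9 * g" using R' B' by (auto simp: min_def max_def)
  moreover have "2 * g \<le> card (?S \<inter> R)" "card (?S \<inter> R) \<le> 7 * g"
    unfolding red using R' \<open>9 * g \<le> r + b\<close> assms(2) by auto
  moreover have "?S \<subseteq> R \<union> B" using R' B' by blast
  ultimately have "star_packing R B ?S (2 * g)" by (intro packing_multiple_of_nine)
  then obtain X where X: "X \<subseteq> ?S" "K13_coverable R B X" "card X = 4 * (2 * g)"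
    by (rule card_K13_coverable_of_packing)
  have "card X \<le> C_set R B" using X R' B' RB by (intro C_set_ge) auto
  then show ?thesis using X by simp
qed

theorem theorem18:
  fixes r b :: nat and \<alpha> :: real
  assumes "r > 0" and "b > 0"
    and "\<alpha> = real b / real r"
    and "4 / 5 \<le> \<alpha>" and "\<alpha> \<le> 1"
  shows "real (C_num r b) \<ge> 8 / 9 * (real r + real b - 8)"
proof -
  obtain R B where RB: "rb_set r b R B" "C_num r b = C_set R B" by (rule C_num_attained)
  have "real b \<le> real r" "4 * real r \<le> 5 * real b"
    using assms(1,4,5) unfolding assms(3) by (auto simp: field_simps)
  then have "b \<le> r" "4 * r \<le> 5 * b" by linarith+
  define q where "q = (r + b) div 9"
  have "8 * q \<le> C_num r b"
    using C_set_lower_bound[OF RB(1) \<open>b \<le> r\<close> \<open>4 * r \<le> 5 * b\<close> q_def] RB(2) by simp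
  \<comment> \<open>The remainder modulo 9 is the 8 in the bound.\<close>
  moreover have "r + b \<le> 9 * q + 8" unfolding q_def by presburger
  ultimately have "8 * real q \<le> real (C_num r b)" "real r + real b \<le> 9 * real q + 8" by linarith+
  then show ?thesis by (simp add: field_simps)
qed

end
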